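(* Let $G$ be a small category and let $A=B\rtimes_\alpha^\sigma G$ be a crossed product algebra. Then an ideal of $B$ is $G$-invariant if and only if it is $A$-invariant.
   Context: Rings are not necessarily associative. Ideals are two-sided. For subsets $X,Y$ of $A$, $XY$ denotes the set of all finite sums of products $xy$ with $x\in X$, $y\in Y$. For a small category $G$, $\mathrm{ob}(G)$ and $\mathrm{mor}(G)$ are its objects and morphisms (objects are identified with their identity morphisms), $d(g)$ and $c(g)$ are the domain and codomain of a morphism $g$, and $G^{(2)}$ is the set of pairs $(g,h)$ of morphisms with $d(g)=c(h)$. Crossed product: Let $\mathrm{Ring}$ be the category of unital rings and ring homomorphisms preserving the multiplicative identity. A crossed system is a pair $(\sigma,\alpha)$ where $\sigma:G\to\mathrm{Ring}$ is a functor, with $B_e$ denoting the ring assigned to $e\in\mathrm{ob}(G)$ and $\sigma_g:B_{d(g)}\to B_{c(g)}$ the homomorphism assigned to $g\in\mathrm{mor}(G)$, and $\alpha$ assigns to each $(g,h)\in G^{(2)}$ a unit $\alpha_{g,h}$ of $B_{c(g)}$ which associates and commutes with elements of $B_{c(g)}$, i.e. $\alpha_{g,h}(bc)=(b\alpha_{g,h})c=b(\alpha_{g,h}c)=(bc)\alpha_{g,h}$ for all $b,c\in B_{c(g)}$; moreover $\alpha_{c(g),g}=\alpha_{g,d(g)}=1_{B_{c(g)}}$ for all $g$. Put $B=\bigoplus_{e\in\mathrm{ob}(G)}B_e$. The crossed product algebra $A=B\rtimes_\alpha^\sigma G$ is the set of formal sums $\sum_{g\in\mathrm{mor}(G)}b_gu_g$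 with $b_g\in B_{c(g)}$, all but finitely many zero, with pointwise addition and multiplication the biadditive extension of $(a_gu_g)(b_hu_h)=a_g\sigma_g(b_h)\alpha_{g,h}u_{gh}$ if $d(g)=c(h)$ and $(a_gu_g)(b_hu_h)=0$ otherwise. It is graded by $A_g=B_{c(g)}u_g$ and locally unital (each $A_e$, $e\in\mathrm{ob}(G)$, is non-zero and unital with identity $1_{B_e}u_e$); $B$ is identified with $\bigoplus_{e\in\mathrm{ob}(G)}A_e$. For an ideal $I$ of $B$ put $I_e=I\cap B_e$. $I$ is $G$-invariant if $\sigma_g(I_{d(g)})\subseteq I_{c(g)}$ for all $g\in\mathrm{mor}(G)$. $I$ is $A$-invariant if $AI\subseteq IA$. *)

theory Defs
  imports "HOL-Algebra.Ring" "HOL-Algebra.AbelCoset"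
begin

section \<open>Rings that need not be associative\<close>

text \<open>
  The library locale \<^locale>\<open>ring\<close> assumes associativity, so the notions needed here are
  restated over the same record type.  The field \<^const>\<open>one\<close> is ignored by
  \<open>nonassoc_ring\<close> and \<open>nonassoc_ideal\<close>, which also cover rings without identity.
\<close>

locale nonassoc_ring = abelian_group R for R (structure) +
  assumes mult_closed: "\<lbrakk>x \<in> carrier R; y \<in> carrier R\<rbrakk> \<Longrightarrow> x \<otimes> y \<in> carrier R"
    and distr_left: "\<lbrakk>x \<in> carrier R; y \<in> carrier R; z \<in> carrier R\<rbrakk>
          \<Longrightarrow> (x \<oplus> y) \<otimes> z = x \<otimes> z \<oplus> y \<otimes> z"
    and distr_right: "\<lbrakk>x \<in> carrier R; y \<in> carrier R; z \<in> carrier R\<rbrakk>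
          \<Longrightarrow> z \<otimes> (x \<oplus> y) = z \<otimes> x \<oplus> z \<otimes> y"

locale unital_nonassoc_ring = nonassoc_ring +
  assumes unit_closed: "\<one> \<in> carrier R"
    and unit_left: "x \<in> carrier R \<Longrightarrow> \<one> \<otimes> x = x"
    and unit_right: "x \<in> carrier R \<Longrightarrow> x \<otimes> \<one> = x"

locale nonassoc_ideal = additive_subgroup I R for I and R (structure) +
  assumes mult_in_left: "\<lbrakk>a \<in> I; x \<in> carrier R\<rbrakk> \<Longrightarrow> x \<otimes> a \<in> I"
    and mult_in_right: "\<lbrakk>a \<in> I; x \<in> carrier R\<rbrakk> \<Longrightarrow> a \<otimes> x \<in> I"

definition set_prod :: "('a, 'm) ring_scheme \<Rightarrow> 'a set \<Rightarrow> 'a set \<Rightarrow> 'a set" where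
  "set_prod R X Y =
     {(\<Oplus>\<^bsub>R\<^esub>i\<in>{..<n}. x i \<otimes>\<^bsub>R\<^esub> y i) | (n::nat) x y. \<forall>i<n. x i \<in> X \<and> y i \<in> Y}"


section \<open>Small categories\<close>

text \<open>Objects are identified with their identity morphisms; \<open>Comp G g h\<close> is \<open>g h\<close>, that is,
  \<open>g\<close> after \<open>h\<close>, and is meaningful only if \<open>Dom G g = Cod G h\<close>.\<close>

record 'g category =
  Ob :: "'g set"
  Mor :: "'g set"
  Dom :: "'g \<Rightarrow> 'g"
  Cod :: "'g \<Rightarrow> 'g"
  Comp :: "'g \<Rightarrow> 'g \<Rightarrow> 'g"

locale small_category =
  fixes G :: "'g category"
  assumes Ob_subset: "Ob G \<subseteq> Mor G"
    and Dom_in: "g \<in> Mor G \<Longrightarrow> Dom G g \<in> Ob G"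
    and Cod_in: "g \<in> Mor G \<Longrightarrow> Cod G g \<in> Ob G"
    and Dom_Ob: "e \<in> Ob G \<Longrightarrow> Dom G e = e"
    and Cod_Ob: "e \<in> Ob G \<Longrightarrow> Cod G e = e"
    and Comp_in: "\<lbrakk>g \<in> Mor G; h \<in> Mor G; Dom G g = Cod G h\<rbrakk> \<Longrightarrow> Comp G g h \<in> Mor G"
    and Dom_Comp: "\<lbrakk>g \<in> Mor G; h \<in> Mor G; Dom G g = Cod G h\<rbrakk>
          \<Longrightarrow> Dom G (Comp G g h) = Dom G h"
    and Cod_Comp: "\<lbrakk>g \<in> Mor G; h \<in> Mor G; Dom G g = Cod G h\<rbrakk>
          \<Longrightarrow> Cod G (Comp G g h) = Cod G g"
    and Comp_assoc: "\<lbrakk>g \<in> Mor G; h \<in> Mor G; k \<in> Mor G; Dom G g = Cod G h; Dom G h = Cod G k\<rbrakk>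
          \<Longrightarrow> Comp G (Comp G g h) k = Comp G g (Comp G h k)"
    and Comp_Cod: "g \<in> Mor G \<Longrightarrow> Comp G (Cod G g) g = g"
    and Comp_Dom: "g \<in> Mor G \<Longrightarrow> Comp G g (Dom G g) = g"


section \<open>Crossed systems and crossed products\<close>

text \<open>
  The rings \<open>B e\<close> are carriers inside one ambient type and may overlap; no relation between
  different \<open>B e\<close> is intended.  They are not required to be non-zero.  No cocycle condition
  is imposed on \<open>\<alpha>\<close>, in accordance with the crossed product being possibly non-associative.
\<close>

locale crossed_system = small_category G
  for G :: "'g category" +
  fixes B :: "'g \<Rightarrow> 'b ring"
    and \<sigma> :: "'g \<Rightarrow> 'b \<Rightarrow> 'b"
    and \<alpha> :: "'g \<Rightarrow> 'g \<Rightarrow> 'b"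
  assumes B_ring: "e \<in> Ob G \<Longrightarrow> unital_nonassoc_ring (B e)"
    and \<sigma>_hom: "g \<in> Mor G \<Longrightarrow> \<sigma> g \<in> ring_hom (B (Dom G g)) (B (Cod G g))"
    and \<sigma>_Ob: "\<lbrakk>e \<in> Ob G; b \<in> carrier (B e)\<rbrakk> \<Longrightarrow> \<sigma> e b = b"
    and \<sigma>_Comp: "\<lbrakk>g \<in> Mor G; h \<in> Mor G; Dom G g = Cod G h; b \<in> carrier (B (Dom G h))\<rbrakk>
          \<Longrightarrow> \<sigma> (Comp G g h) b = \<sigma> g (\<sigma> h b)"
    and \<alpha>_unit: "\<lbrakk>g \<in> Mor G; h \<in> Mor G; Dom G g = Cod G h\<rbrakk> \<Longrightarrow> \<alpha> g h \<in> Units (B (Cod G g))"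
    and \<alpha>_assoc_comm:
      "\<lbrakk>g \<in> Mor G; h \<in> Mor G; Dom G g = Cod G h;
        b \<in> carrier (B (Cod G g)); c \<in> carrier (B (Cod G g))\<rbrakk>
       \<Longrightarrow> \<alpha> g h \<otimes>\<^bsub>B (Cod G g)\<^esub> (b \<otimes>\<^bsub>B (Cod G g)\<^esub> c)
             = (b \<otimes>\<^bsub>B (Cod G g)\<^esub> \<alpha> g h) \<otimes>\<^bsub>B (Cod G g)\<^esub> c
         \<and> (b \<otimes>\<^bsub>B (Cod G g)\<^esub> \<alpha> g h) \<otimes>\<^bsub>B (Cod G g)\<^esub> c
             = b \<otimes>\<^bsub>B (Cod G g)\<^esub> (\<alpha> g h \<otimes>\<^bsub>B (Cod G g)\<^esub> c)
         \<and> b \<otimes>\<^bsub>B (Cod G g)\<^esub> (\<alpha> g h \<otimes>\<^bsub>B (Cod G g)\<^esub> c)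
             = (b \<otimes>\<^bsub>B (Cod G g)\<^esub> c) \<otimes>\<^bsub>B (Cod G g)\<^esub> \<alpha> g h"
    and \<alpha>_Cod: "g \<in> Mor G \<Longrightarrow> \<alpha> (Cod G g) g = \<one>\<^bsub>B (Cod G g)\<^esub>"
    and \<alpha>_Dom: "g \<in> Mor G \<Longrightarrow> \<alpha> g (Dom G g) = \<one>\<^bsub>B (Cod G g)\<^esub>"

text \<open>The external direct sum of the rings \<open>B e\<close>.  The field \<^const>\<open>one\<close> lies
  in the carrier, and is then an identity, exactly if all but finitely many \<open>B e\<close> are zero
  (for instance if \<open>E\<close> is finite); otherwise it is meaningless and never used.  The same
  applies to the crossed product below.\<close>

definition direct_sum :: "'g set \<Rightarrow> ('g \<Rightarrow> 'b ring) \<Rightarrow> ('g \<Rightarrow> 'b) ring" where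
  "direct_sum E B =
     \<lparr>carrier = {b \<in> \<Pi>\<^sub>E e\<in>E. carrier (B e). finite {e \<in> E. b e \<noteq> \<zero>\<^bsub>B e\<^esub>}},
      mult = (\<lambda>a b. \<lambda>e\<in>E. a e \<otimes>\<^bsub>B e\<^esub> b e),
      one = (\<lambda>e\<in>E. \<one>\<^bsub>B e\<^esub>),
      zero = (\<lambda>e\<in>E. \<zero>\<^bsub>B e\<^esub>),
      add = (\<lambda>a b. \<lambda>e\<in>E. a e \<oplus>\<^bsub>B e\<^esub> b e)\<rparr>"

definition summand_incl :: "'g set \<Rightarrow> ('g \<Rightarrow> 'b ring) \<Rightarrow> 'g \<Rightarrow> 'b \<Rightarrow> ('g \<Rightarrow> 'b)" where
  "summand_incl E B e b = (\<lambda>e'\<in>E. if e' = e then b else \<zero>\<^bsub>B e'\<^esub>)"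

text \<open>The formal sum \<open>\<Sum> b\<^sub>g u\<^sub>g\<close> is the function \<open>g \<mapsto> b\<^sub>g\<close> on the morphisms.  The
  coefficient of \<open>u\<^sub>k\<close> in a product collects the products of non-zero coefficients along the
  (finitely many) factorisations \<open>k = g h\<close>; restricting to non-zero coefficients makes the index
  set finite, as \<^const>\<open>finsum\<close> requires.  Lemmas \<open>crossed_product_nonassoc_ring\<close> and
  \<open>homogeneous_mult\<close> confirm that this is the biadditive extension of the usual rule.\<close>

definition crossed_product ::
  "'g category \<Rightarrow> ('g \<Rightarrow> 'b ring) \<Rightarrow> ('g \<Rightarrow> 'b \<Rightarrow> 'b) \<Rightarrow> ('g \<Rightarrow> 'g \<Rightarrow> 'b) \<Rightarrow> ('g \<Rightarrow> 'b) ring" where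
  "crossed_product G B \<sigma> \<alpha> =
     \<lparr>carrier = {a \<in> \<Pi>\<^sub>E g\<in>Mor G. carrier (B (Cod G g)).
                   finite {g \<in> Mor G. a g \<noteq> \<zero>\<^bsub>B (Cod G g)\<^esub>}},
      mult = (\<lambda>a b. \<lambda>k\<in>Mor G.
        finsum (B (Cod G k))
          (\<lambda>(g, h). (a g \<otimes>\<^bsub>B (Cod G k)\<^esub> \<sigma> g (b h)) \<otimes>\<^bsub>B (Cod G k)\<^esub> \<alpha> g h)
          {(g, h). g \<in> Mor G \<and> h \<in> Mor G \<and> Dom G g = Cod G h \<and> Comp G g h = k
                 \<and> a g \<noteq> \<zero>\<^bsub>B (Cod G g)\<^esub> \<and> b h \<noteq> \<zero>\<^bsub>B (Cod G h)\<^esub>}),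
      one = (\<lambda>g\<in>Mor G. if g \<in> Ob G then \<one>\<^bsub>B (Cod G g)\<^esub> else \<zero>\<^bsub>B (Cod G g)\<^esub>),
      zero = (\<lambda>g\<in>Mor G. \<zero>\<^bsub>B (Cod G g)\<^esub>),
      add = (\<lambda>a b. \<lambda>g\<in>Mor G. a g \<oplus>\<^bsub>B (Cod G g)\<^esub> b g)\<rparr>"

definition homogeneous :: "'g category \<Rightarrow> ('g \<Rightarrow> 'b ring) \<Rightarrow> 'g \<Rightarrow> 'b \<Rightarrow> ('g \<Rightarrow> 'b)" where
  "homogeneous G B g b = (\<lambda>k\<in>Mor G. if k = g then b else \<zero>\<^bsub>B (Cod G k)\<^esub>)"

text \<open>The identification of \<open>B\<close> with the sum of the \<open>A\<^sub>e\<close> over the objects \<open>e\<close>: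
  \<open>b \<mapsto> \<Sum> b\<^sub>e u\<^sub>e\<close>.\<close>

definition base_embed :: "'g category \<Rightarrow> ('g \<Rightarrow> 'b ring) \<Rightarrow> ('g \<Rightarrow> 'b) \<Rightarrow> ('g \<Rightarrow> 'b)" where
  "base_embed G B b = (\<lambda>g\<in>Mor G. if g \<in> Ob G then b g else \<zero>\<^bsub>B (Cod G g)\<^esub>)"


section \<open>Invariant ideals\<close>

text \<open>\<open>I \<inter> B\<^sub>e\<close>, viewed as a subset of the ring \<open>B e\<close>.\<close>

definition ideal_component ::
  "'g category \<Rightarrow> ('g \<Rightarrow> 'b ring) \<Rightarrow> ('g \<Rightarrow> 'b) set \<Rightarrow> 'g \<Rightarrow> 'b set" where
  "ideal_component G B I e = {b \<in> carrier (B e). summand_incl (Ob G) B e b \<in> I}"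

definition G_invariant ::
  "'g category \<Rightarrow> ('g \<Rightarrow> 'b ring) \<Rightarrow> ('g \<Rightarrow> 'b \<Rightarrow> 'b) \<Rightarrow> ('g \<Rightarrow> 'b) set \<Rightarrow> bool" where
  "G_invariant G B \<sigma> I \<longleftrightarrow>
     (\<forall>g\<in>Mor G. \<sigma> g ` ideal_component G B I (Dom G g) \<subseteq> ideal_component G B I (Cod G g))"

definition A_invariant ::
  "'g category \<Rightarrow> ('g \<Rightarrow> 'b ring) \<Rightarrow> ('g \<Rightarrow> 'b \<Rightarrow> 'b) \<Rightarrow> ('g \<Rightarrow> 'g \<Rightarrow> 'b) \<Rightarrow> ('g \<Rightarrow> 'b) set \<Rightarrow> bool"
  where
  "A_invariant G B \<sigma> \<alpha> I \<longleftrightarrow>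
     (let A = crossed_product G B \<sigma> \<alpha>; J = base_embed G B ` I
      in set_prod A (carrier A) J \<subseteq> set_prod A J (carrier A))"


section \<open>Well-definedness of the constructions\<close>

context nonassoc_ring
begin

lemma zero_mult: "x \<in> carrier R \<Longrightarrow> \<zero> \<otimes> x = \<zero>"
  using distr_left[of \<zero> \<zero> x] mult_closed[of \<zero> x] by (simp add: l_zero)

lemma mult_zero: "x \<in> carrier R \<Longrightarrow> x \<otimes> \<zero> = \<zero>"
  using distr_right[of \<zero> \<zero> x] mult_closed[of x \<zero>] by (simp add: l_zero)

end

lemma restricted_sum_abelian_group:
  assumes R: "\<And>i. i \<in> S \<Longrightarrow> abelian_group (R i)"
    and carrier: "carrier A = {a \<in> \<Pi>\<^sub>E i\<in>S. carrier (R i). finite {i \<in> S. a i \<noteq> \<zero>\<^bsub>R i\<^esub>}}"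
    and zero: "zero A = (\<lambda>i\<in>S. \<zero>\<^bsub>R i\<^esub>)"
    and add: "add A = (\<lambda>a b. \<lambda>i\<in>S. a i \<oplus>\<^bsub>R i\<^esub> b i)"
  shows "abelian_group A"
proof -
  have am: "abelian_monoid (R i)" if "i \<in> S" for i
    using R[OF that] by (rule abelian_group.axioms)
  have mem: "a i \<in> carrier (R i)" if "a \<in> carrier A" "i \<in> S" for a i
    using that unfolding carrier by (auto dest: PiE_mem)
  have fin: "finite {i \<in> S. a i \<noteq> \<zero>\<^bsub>R i\<^esub>}" if "a \<in> carrier A" for a
    using that unfolding carrier by simp
  have memI: "(\<lambda>i\<in>S. f i) \<in> carrier A"
    if "\<And>i. i \<in> S \<Longrightarrow> f i \<in> carrier (R i)" "finite F" "\<And>i. \<lbrakk>i \<in> S; i \<notin> F\<rbrakk> \<Longrightarrow> f i = \<zero>\<^bsub>R i\<^esub>" for f F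
  proof -
    have "{i \<in> S. (\<lambda>i\<in>S. f i) i \<noteq> \<zero>\<^bsub>R i\<^esub>} \<subseteq> F" using that(3) by auto
    then have "finite {i \<in> S. (\<lambda>i\<in>S. f i) i \<noteq> \<zero>\<^bsub>R i\<^esub>}"
      using that(2) by (rule finite_subset)
    moreover have "(\<lambda>i\<in>S. f i) \<in> (\<Pi>\<^sub>E i\<in>S. carrier (R i))"
      by (rule restrict_PiE_iff[THEN iffD2]) (use that(1) in blast)
    ultimately show ?thesis unfolding carrier by blast
  qed
  have ext: "a i = undefined" if "a \<in> carrier A" "i \<notin> S" for a i
    using that unfolding carrier by (auto simp: PiE_def extensional_def)
  show ?thesis
  proof (rule abelian_groupI)
    fix x y assume x: "x \<in> carrier A" and y: "y \<in> carrier A"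
    show "x \<oplus>\<^bsub>A\<^esub> y \<in> carrier A" unfolding add
    proof (rule memI)
      show "finite ({i \<in> S. x i \<noteq> \<zero>\<^bsub>R i\<^esub>} \<union> {i \<in> S. y i \<noteq> \<zero>\<^bsub>R i\<^esub>})"
        using fin x y by blast
    next
      fix i assume i: "i \<in> S" "i \<notin> {i \<in> S. x i \<noteq> \<zero>\<^bsub>R i\<^esub>} \<union> {i \<in> S. y i \<noteq> \<zero>\<^bsub>R i\<^esub>}"
      then have "x i = \<zero>\<^bsub>R i\<^esub>" "y i = \<zero>\<^bsub>R i\<^esub>" by auto
      then show "x i \<oplus>\<^bsub>R i\<^esub> y i = \<zero>\<^bsub>R i\<^esub>"
        using abelian_monoid.l_zero[OF am abelian_monoid.zero_closed[OF am]] i by metis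
    qed (rule abelian_monoid.a_closed[OF am mem[OF x] mem[OF y]])
    show "x \<oplus>\<^bsub>A\<^esub> y = y \<oplus>\<^bsub>A\<^esub> x" unfolding add
      by (rule restrict_ext) (rule abelian_monoid.a_comm[OF am mem[OF x] mem[OF y]])
  next
    fix x y z assume x: "x \<in> carrier A" and y: "y \<in> carrier A" and z: "z \<in> carrier A"
    have "x i \<oplus>\<^bsub>R i\<^esub> y i \<oplus>\<^bsub>R i\<^esub> z i = x i \<oplus>\<^bsub>R i\<^esub> (y i \<oplus>\<^bsub>R i\<^esub> z i)" if "i \<in> S" for i
      using abelian_monoid.a_assoc[OF am mem[OF x] mem[OF y] mem[OF z]] that by blast
    then show "x \<oplus>\<^bsub>A\<^esub> y \<oplus>\<^bsub>A\<^esub> z = x \<oplus>\<^bsub>A\<^esub> (y \<oplus>\<^bsub>A\<^esub> z)"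
      unfolding add by (intro restrict_ext) simp
  next
    show "\<zero>\<^bsub>A\<^esub> \<in> carrier A"
      unfolding zero by (rule memI[of _ "{}"]) (auto intro: abelian_monoid.zero_closed[OF am])
  next
    fix x assume x: "x \<in> carrier A"
    have "\<zero>\<^bsub>R i\<^esub> \<oplus>\<^bsub>R i\<^esub> x i = x i" if "i \<in> S" for i
      using abelian_monoid.l_zero[OF am mem[OF x]] that by blast
    then show "\<zero>\<^bsub>A\<^esub> \<oplus>\<^bsub>A\<^esub> x = x"
      unfolding add zero using ext[OF x] by (auto simp: fun_eq_iff)
    let ?y = "\<lambda>i\<in>S. \<ominus>\<^bsub>R i\<^esub> x i"
    have "?y \<in> carrier A"
    proof (rule memI[OF _ fin[OF x]])
      show "\<ominus>\<^bsub>R i\<^esub> x i \<in> carrier (R i)" if "i \<in> S" for i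
        using abelian_group.a_inv_closed[OF R mem[OF x]] that by blast
      show "\<ominus>\<^bsub>R i\<^esub> x i = \<zero>\<^bsub>R i\<^esub>" if "i \<in> S" "i \<notin> {i \<in> S. x i \<noteq> \<zero>\<^bsub>R i\<^esub>}" for i
      proof -
        interpret Ri: abelian_group "R i" using R that(1) .
        show ?thesis using that Ri.minus_equality[OF Ri.l_zero[OF Ri.zero_closed]] by simp
      qed
    qed
    moreover have "\<ominus>\<^bsub>R i\<^esub> x i \<oplus>\<^bsub>R i\<^esub> x i = \<zero>\<^bsub>R i\<^esub>" if "i \<in> S" for i
      using abelian_group.l_neg[OF R mem[OF x]] that by blast
    then have "?y \<oplus>\<^bsub>A\<^esub> x = \<zero>\<^bsub>A\<^esub>" unfolding add zero by (intro restrict_ext) simp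
    ultimately show "\<exists>y\<in>carrier A. y \<oplus>\<^bsub>A\<^esub> x = \<zero>\<^bsub>A\<^esub>" by blast
  qed
qed

lemma direct_sum_nonassoc_ring:
  assumes "\<And>e. e \<in> E \<Longrightarrow> nonassoc_ring (B e)"
  shows "nonassoc_ring (direct_sum E B)"
proof -
  have ag: "abelian_group (B e)" if "e \<in> E" for e
    using assms[OF that] by (simp add: nonassoc_ring_def)
  have mem: "a e \<in> carrier (B e)" if "a \<in> carrier (direct_sum E B)" "e \<in> E" for a e
    using that by (auto simp: direct_sum_def dest: PiE_mem)
  interpret D: abelian_group "direct_sum E B"
    by (rule restricted_sum_abelian_group[where S = E and R = B]) (auto simp: direct_sum_def ag)
  show ?thesis
  proof
    fix x y assume x: "x \<in> carrier (direct_sum E B)" and y: "y \<in> carrier (direct_sum E B)"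
    have "finite {e \<in> E. (\<lambda>e\<in>E. x e \<otimes>\<^bsub>B e\<^esub> y e) e \<noteq> \<zero>\<^bsub>B e\<^esub>}"
    proof (rule finite_subset)
      show "{e \<in> E. (\<lambda>e\<in>E. x e \<otimes>\<^bsub>B e\<^esub> y e) e \<noteq> \<zero>\<^bsub>B e\<^esub>} \<subseteq> {e \<in> E. x e \<noteq> \<zero>\<^bsub>B e\<^esub>}"
        using nonassoc_ring.zero_mult[OF assms mem[OF y]] by auto
    qed (use x in \<open>auto simp: direct_sum_def\<close>)
    then show "x \<otimes>\<^bsub>direct_sum E B\<^esub> y \<in> carrier (direct_sum E B)"
      using nonassoc_ring.mult_closed[OF assms mem[OF x] mem[OF y]]
      by (simp add: direct_sum_def)
  next
    fix x y z
    assume x: "x \<in> carrier (direct_sum E B)" and y: "y \<in> carrier (direct_sum E B)"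
      and z: "z \<in> carrier (direct_sum E B)"
    show "(x \<oplus>\<^bsub>direct_sum E B\<^esub> y) \<otimes>\<^bsub>direct_sum E B\<^esub> z =
        x \<otimes>\<^bsub>direct_sum E B\<^esub> z \<oplus>\<^bsub>direct_sum E B\<^esub> y \<otimes>\<^bsub>direct_sum E B\<^esub> z"
      using nonassoc_ring.distr_left[OF assms mem[OF x] mem[OF y] mem[OF z]]
      by (simp add: direct_sum_def fun_eq_iff)
    show "z \<otimes>\<^bsub>direct_sum E B\<^esub> (x \<oplus>\<^bsub>direct_sum E B\<^esub> y) =
        z \<otimes>\<^bsub>direct_sum E B\<^esub> x \<oplus>\<^bsub>direct_sum E B\<^esub> z \<otimes>\<^bsub>direct_sum E B\<^esub> y"
      using nonassoc_ring.distr_right[OF assms mem[OF x] mem[OF y] mem[OF z]]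
      by (simp add: direct_sum_def fun_eq_iff)
  qed
qed

context crossed_system
begin

abbreviation A where "A \<equiv> crossed_product G B \<sigma> \<alpha>"

definition supp :: "('g \<Rightarrow> 'b) \<Rightarrow> 'g set" where
  "supp a = {g \<in> Mor G. a g \<noteq> \<zero>\<^bsub>B (Cod G g)\<^esub>}"

lemma BC_ring: "g \<in> Mor G \<Longrightarrow> unital_nonassoc_ring (B (Cod G g))"
  by (simp add: B_ring Cod_in)

lemma A_carrier: "a \<in> carrier A \<longleftrightarrow> a \<in> (\<Pi>\<^sub>E g\<in>Mor G. carrier (B (Cod G g))) \<and> finite (supp a)"
  by (simp add: crossed_product_def supp_def)

lemma A_mem: "\<lbrakk>a \<in> carrier A; g \<in> Mor G\<rbrakk> \<Longrightarrow> a g \<in> carrier (B (Cod G g))"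
  unfolding A_carrier by (auto dest: PiE_mem)

lemma A_abelian_group: "abelian_group A"
proof (rule restricted_sum_abelian_group[where S = "Mor G" and R = "\<lambda>g. B (Cod G g)"])
  show "abelian_group (B (Cod G g))" if "g \<in> Mor G" for g
    using BC_ring[OF that] by (simp add: unital_nonassoc_ring_def nonassoc_ring_def)
qed (auto simp: crossed_product_def)

lemma \<sigma>_closed: "\<lbrakk>g \<in> Mor G; b \<in> carrier (B (Dom G g))\<rbrakk> \<Longrightarrow> \<sigma> g b \<in> carrier (B (Cod G g))"
  by (rule ring_hom_closed[OF \<sigma>_hom])

lemma \<sigma>_add: "\<lbrakk>g \<in> Mor G; x \<in> carrier (B (Dom G g)); y \<in> carrier (B (Dom G g))\<rbrakk>
    \<Longrightarrow> \<sigma> g (x \<oplus>\<^bsub>B (Dom G g)\<^esub> y) = \<sigma> g x \<oplus>\<^bsub>B (Cod G g)\<^esub> \<sigma> g y"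
  by (rule ring_hom_add[OF \<sigma>_hom])

lemma \<sigma>_zero: 
  assumes "g \<in> Mor G" shows "\<sigma> g \<zero>\<^bsub>B (Dom G g)\<^esub> = \<zero>\<^bsub>B (Cod G g)\<^esub>"
proof -
  interpret D: unital_nonassoc_ring "B (Dom G g)" using assms B_ring Dom_in by blast
  interpret C: unital_nonassoc_ring "B (Cod G g)" using assms BC_ring by blast
  have "\<sigma> g \<zero>\<^bsub>B (Dom G g)\<^esub> \<oplus>\<^bsub>B (Cod G g)\<^esub> \<sigma> g \<zero>\<^bsub>B (Dom G g)\<^esub> = \<sigma> g \<zero>\<^bsub>B (Dom G g)\<^esub>"
    using \<sigma>_add[OF assms D.zero_closed D.zero_closed] D.l_zero[OF D.zero_closed] by simp
  then show ?thesis
    using C.add.l_cancel_one[OF \<sigma>_closed \<sigma>_closed] assms by simp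
qed

lemma \<alpha>_closed: "\<lbrakk>g \<in> Mor G; h \<in> Mor G; Dom G g = Cod G h\<rbrakk> \<Longrightarrow> \<alpha> g h \<in> carrier (B (Cod G g))"
  using \<alpha>_unit by (auto simp: Units_def)

definition factors :: "'g set \<Rightarrow> 'g set \<Rightarrow> 'g \<Rightarrow> ('g \<times> 'g) set" where
  "factors S T k = {(g, h). g \<in> S \<and> h \<in> T \<and> g \<in> Mor G \<and> h \<in> Mor G \<and> Dom G g = Cod G h \<and> Comp G g h = k}"

definition prod_term :: "('g \<Rightarrow> 'b) \<Rightarrow> ('g \<Rightarrow> 'b) \<Rightarrow> 'g \<times> 'g \<Rightarrow> 'b" where
  "prod_term a b p = (a (fst p) \<otimes>\<^bsub>B (Cod G (fst p))\<^esub> \<sigma> (fst p) (b (snd p)))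
      \<otimes>\<^bsub>B (Cod G (fst p))\<^esub> \<alpha> (fst p) (snd p)"

lemma finite_factors: "\<lbrakk>finite S; finite T\<rbrakk> \<Longrightarrow> finite (factors S T k)"
  by (rule finite_subset[of _ "S \<times> T"]) (auto simp: factors_def)

lemma factors_Cod: "(g, h) \<in> factors S T k \<Longrightarrow> Cod G g = Cod G k"
  by (auto simp: factors_def Cod_Comp)

lemma factorsE:
  assumes "p \<in> factors S T k"
  obtains g h where "p = (g, h)" "g \<in> Mor G" "h \<in> Mor G" "Dom G g = Cod G h" "Cod G g = Cod G k"
proof -
  obtain g h where p: "p = (g, h)" by (cases p)
  show thesis
    using assms factors_Cod[of g h S T k] unfolding p by (intro that[OF p]) (auto simp: factors_def)
qed

lemma prod_term_closed:
  assumes "a \<in> carrier A" "b \<in> carrier A" "p \<in> factors S T k"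
  shows "prod_term a b p \<in> carrier (B (Cod G k))"
proof -
  obtain g h where p: "p = (g, h)" "g \<in> Mor G" "h \<in> Mor G" "Dom G g = Cod G h" "Cod G g = Cod G k"
    using assms(3) by (rule factorsE)
  interpret C: unital_nonassoc_ring "B (Cod G g)" using p BC_ring by blast
  have "a g \<in> carrier (B (Cod G g))" "b h \<in> carrier (B (Dom G g))"
    using A_mem[OF assms(1) p(2)] A_mem[OF assms(2) p(3)] p(4) by simp_all
  then show ?thesis
    using C.mult_closed[OF C.mult_closed[OF _ \<sigma>_closed] \<alpha>_closed] p
    by (simp add: prod_term_def)
qed

lemma mult_eq:
  assumes "a \<in> carrier A" "b \<in> carrier A" "k \<in> Mor G"
    and "finite S" "finite T" "supp a \<subseteq> S" "supp b \<subseteq> T"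
  shows "(a \<otimes>\<^bsub>A\<^esub> b) k = finsum (B (Cod G k)) (prod_term a b) (factors S T k)"
proof -
  interpret K: unital_nonassoc_ring "B (Cod G k)" using assms BC_ring by blast
  have "(a \<otimes>\<^bsub>A\<^esub> b) k = finsum (B (Cod G k))
      (\<lambda>(g, h). (a g \<otimes>\<^bsub>B (Cod G k)\<^esub> \<sigma> g (b h)) \<otimes>\<^bsub>B (Cod G k)\<^esub> \<alpha> g h) (factors (supp a) (supp b) k)"
    using assms(3) unfolding crossed_product_def factors_def supp_def
    by (auto intro!: arg_cong[where f = "finsum _ _"])
  also have "\<dots> = finsum (B (Cod G k)) (prod_term a b) (factors (supp a) (supp b) k)"
    by (rule K.finsum_cong') (use prod_term_closed[OF assms(1,2)] in \<open>auto simp: prod_term_def dest: factors_Cod\<close>)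
  also have "\<dots> = finsum (B (Cod G k)) (prod_term a b) (factors S T k)"
  proof (rule K.add.finprod_mono_neutral_cong_left)
    show "finite (factors S T k)" using assms finite_factors by blast
    show "factors (supp a) (supp b) k \<subseteq> factors S T k" using assms by (auto simp: factors_def)
    show "prod_term a b p = \<zero>\<^bsub>B (Cod G k)\<^esub>" if p: "p \<in> factors S T k - factors (supp a) (supp b) k" for p
    proof -
      obtain g h where gh: "p = (g, h)" "g \<in> Mor G" "h \<in> Mor G" "Dom G g = Cod G h"
          "Cod G g = Cod G k"
        using p by (auto elim: factorsE)
      have c: "a g \<in> carrier (B (Cod G k))" "b h \<in> carrier (B (Dom G g))"
        using A_mem[OF assms(1) gh(2)] A_mem[OF assms(2) gh(3)] gh(4,5) by simp_all
      have "a g = \<zero>\<^bsub>B (Cod G k)\<^esub> \<or> b h = \<zero>\<^bsub>B (Dom G g)\<^esub>"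
        using p gh by (auto simp: factors_def supp_def)
      then have "a g \<otimes>\<^bsub>B (Cod G k)\<^esub> \<sigma> g (b h) = \<zero>\<^bsub>B (Cod G k)\<^esub>"
        using K.zero_mult[of "\<sigma> g (b h)"] K.mult_zero[OF c(1)] \<sigma>_closed[OF gh(2) c(2)]
          \<sigma>_zero[OF gh(2)] gh(5) by auto
      then show ?thesis
        using K.zero_mult[of "\<alpha> g h"] \<alpha>_closed[OF gh(2,3,4)] gh by (simp add: prod_term_def)
    qed
  qed (use prod_term_closed[OF assms(1,2)] in auto)
  finally show ?thesis .
qed

lemma prod_term_add:
  assumes "a \<in> carrier A" "b \<in> carrier A" "c \<in> carrier A" "p \<in> factors S T k"
  shows "prod_term (a \<oplus>\<^bsub>A\<^esub> b) c p = prod_term a c p \<oplus>\<^bsub>B (Cod G k)\<^esub> prod_term b c p"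
    and "prod_term c (a \<oplus>\<^bsub>A\<^esub> b) p = prod_term c a p \<oplus>\<^bsub>B (Cod G k)\<^esub> prod_term c b p"
proof -
  obtain g h where p: "p = (g, h)" "g \<in> Mor G" "h \<in> Mor G" "Dom G g = Cod G h" "Cod G g = Cod G k"
    using assms(4) by (rule factorsE)
  interpret C: unital_nonassoc_ring "B (Cod G k)" using BC_ring[OF p(2)] p(5) by simp
  have cl: "x g \<in> carrier (B (Cod G k))" "x h \<in> carrier (B (Dom G g))"
      "\<sigma> g (x h) \<in> carrier (B (Cod G k))" if "x \<in> carrier A" for x
    using A_mem[OF that p(2)] A_mem[OF that p(3)] p(4,5) \<sigma>_closed[of g "x h", OF p(2)] by simp_all
  have al: "\<alpha> g h \<in> carrier (B (Cod G k))" using \<alpha>_closed[OF p(2,3,4)] p(5) by simp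
  have add: "(a \<oplus>\<^bsub>A\<^esub> b) g = a g \<oplus>\<^bsub>B (Cod G k)\<^esub> b g"
      "(a \<oplus>\<^bsub>A\<^esub> b) h = a h \<oplus>\<^bsub>B (Dom G g)\<^esub> b h"
    using p by (auto simp: crossed_product_def)
  have sa: "\<sigma> g (a h \<oplus>\<^bsub>B (Dom G g)\<^esub> b h) = \<sigma> g (a h) \<oplus>\<^bsub>B (Cod G k)\<^esub> \<sigma> g (b h)"
    using \<sigma>_add[OF p(2) cl(2) cl(2)] assms p by simp
  show "prod_term (a \<oplus>\<^bsub>A\<^esub> b) c p = prod_term a c p \<oplus>\<^bsub>B (Cod G k)\<^esub> prod_term b c p"
    "prod_term c (a \<oplus>\<^bsub>A\<^esub> b) p = prod_term c a p \<oplus>\<^bsub>B (Cod G k)\<^esub> prod_term c b p"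
    unfolding prod_term_def p(1) fst_conv snd_conv p(5) add sa
    by (simp_all add: assms cl al C.distr_left C.distr_right C.mult_closed)
qed

theorem crossed_product_nonassoc_ring: "nonassoc_ring A"
proof -
  interpret A: abelian_group A by (rule A_abelian_group)
  have ext: "(x \<otimes>\<^bsub>A\<^esub> y) k = undefined" "(x \<oplus>\<^bsub>A\<^esub> y) k = undefined" if "k \<notin> Mor G" for x y k
    using that by (auto simp: crossed_product_def)
  have closed: "x \<otimes>\<^bsub>A\<^esub> y \<in> carrier A" if x: "x \<in> carrier A" and y: "y \<in> carrier A" for x y
  proof -
    have fin: "finite (supp x)" "finite (supp y)" using x y by (auto simp: A_carrier)
    have m: "(x \<otimes>\<^bsub>A\<^esub> y) k = finsum (B (Cod G k)) (prod_term x y) (factors (supp x) (supp y) k)" 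
      if "k \<in> Mor G" for k
      using mult_eq[OF x y that fin] by simp
    have "(x \<otimes>\<^bsub>A\<^esub> y) k \<in> carrier (B (Cod G k))" if k: "k \<in> Mor G" for k
    proof -
      interpret K: unital_nonassoc_ring "B (Cod G k)" using k BC_ring by blast
      show ?thesis unfolding m[OF k] by (rule K.finsum_closed) (use prod_term_closed x y in auto)
    qed
    moreover have "supp (x \<otimes>\<^bsub>A\<^esub> y) \<subseteq> (\<lambda>(g, h). Comp G g h) ` (supp x \<times> supp y)"
    proof
      fix k assume k: "k \<in> supp (x \<otimes>\<^bsub>A\<^esub> y)"
      then have kM: "k \<in> Mor G" by (simp add: supp_def)
      interpret K: unital_nonassoc_ring "B (Cod G k)" using kM BC_ring by blast
      have "factors (supp x) (supp y) k \<noteq> {}"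
        using k m[OF kM] by (auto simp: supp_def)
      then show "k \<in> (\<lambda>(g, h). Comp G g h) ` (supp x \<times> supp y)"
        by (force simp: factors_def)
    qed
    then have "finite (supp (x \<otimes>\<^bsub>A\<^esub> y))" using fin finite_subset by blast
    ultimately show ?thesis
      using ext by (auto simp: A_carrier PiE_def extensional_def)
  qed
  show ?thesis
  proof
    fix x y z assume x: "x \<in> carrier A" and y: "y \<in> carrier A" and z: "z \<in> carrier A"
    define S where "S = supp x \<union> supp y \<union> supp z \<union> supp (x \<oplus>\<^bsub>A\<^esub> y)"
    have xy: "x \<oplus>\<^bsub>A\<^esub> y \<in> carrier A" using x y by (rule A.a_closed)
    have S: "finite S" using x y z xy by (auto simp: S_def A_carrier)
    have sub: "supp x \<subseteq> S" "supp y \<subseteq> S" "supp z \<subseteq> S" "supp (x \<oplus>\<^bsub>A\<^esub> y) \<subseteq> S"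
      by (auto simp: S_def)
    have eqs: "((x \<oplus>\<^bsub>A\<^esub> y) \<otimes>\<^bsub>A\<^esub> z) k = (x \<otimes>\<^bsub>A\<^esub> z \<oplus>\<^bsub>A\<^esub> y \<otimes>\<^bsub>A\<^esub> z) k \<and>
        (z \<otimes>\<^bsub>A\<^esub> (x \<oplus>\<^bsub>A\<^esub> y)) k = (z \<otimes>\<^bsub>A\<^esub> x \<oplus>\<^bsub>A\<^esub> z \<otimes>\<^bsub>A\<^esub> y) k" for k
    proof (cases "k \<in> Mor G")
      case True
      interpret K: unital_nonassoc_ring "B (Cod G k)" using True BC_ring by blast
      have pw: "(u \<oplus>\<^bsub>A\<^esub> v) k = u k \<oplus>\<^bsub>B (Cod G k)\<^esub> v k" for u v
        using True by (simp add: crossed_product_def)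
      note me = mult_eq[OF _ _ True S S]
      have c: "prod_term u v \<in> factors S S k \<rightarrow> carrier (B (Cod G k))" 
        if "u \<in> carrier A" "v \<in> carrier A" for u v
        using that prod_term_closed by blast
      have "finsum (B (Cod G k)) (prod_term (x \<oplus>\<^bsub>A\<^esub> y) z) (factors S S k)
          = finsum (B (Cod G k)) (\<lambda>p. prod_term x z p \<oplus>\<^bsub>B (Cod G k)\<^esub> prod_term y z p) (factors S S k)"
        by (rule K.finsum_cong') (use c x y z prod_term_add(1) in \<open>auto simp: Pi_def\<close>)
      moreover have "finsum (B (Cod G k)) (prod_term z (x \<oplus>\<^bsub>A\<^esub> y)) (factors S S k)
          = finsum (B (Cod G k)) (\<lambda>p. prod_term z x p \<oplus>\<^bsub>B (Cod G k)\<^esub> prod_term z y p) (factors S S k)"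
        by (rule K.finsum_cong') (use c x y z prod_term_add(2) in \<open>auto simp: Pi_def\<close>)
      ultimately show ?thesis
        unfolding pw using x y z xy sub by (simp add: me K.finsum_addf c)
    qed (simp add: ext)
    show "(x \<oplus>\<^bsub>A\<^esub> y) \<otimes>\<^bsub>A\<^esub> z = x \<otimes>\<^bsub>A\<^esub> z \<oplus>\<^bsub>A\<^esub> y \<otimes>\<^bsub>A\<^esub> z"
      "z \<otimes>\<^bsub>A\<^esub> (x \<oplus>\<^bsub>A\<^esub> y) = z \<otimes>\<^bsub>A\<^esub> x \<oplus>\<^bsub>A\<^esub> z \<otimes>\<^bsub>A\<^esub> y"
      using eqs by (auto simp: fun_eq_iff)
  qed (rule closed)
qed

lemma homogeneous_closed:
  assumes "g \<in> Mor G" "b \<in> carrier (B (Cod G g))"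
  shows "homogeneous G B g b \<in> carrier A"
proof -
  have "supp (homogeneous G B g b) \<subseteq> {g}" by (auto simp: supp_def homogeneous_def)
  moreover have "\<zero>\<^bsub>B (Cod G k)\<^esub> \<in> carrier (B (Cod G k))" if "k \<in> Mor G" for k
    using BC_ring[OF that] 
    by (simp add: unital_nonassoc_ring_def nonassoc_ring_def abelian_group_def abelian_monoid.zero_closed)
  ultimately show ?thesis
    using assms by (auto simp: A_carrier homogeneous_def intro: finite_subset)
qed

theorem homogeneous_mult:
  assumes "g \<in> Mor G" "h \<in> Mor G" "a \<in> carrier (B (Cod G g))" "b \<in> carrier (B (Cod G h))"
  shows "homogeneous G B g a \<otimes>\<^bsub>A\<^esub> homogeneous G B h b =
    (if Dom G g = Cod G h
     then homogeneous G B (Comp G g h) ((a \<otimes>\<^bsub>B (Cod G g)\<^esub> \<sigma> g b) \<otimes>\<^bsub>B (Cod G g)\<^esub> \<alpha> g h)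
     else \<zero>\<^bsub>A\<^esub>)" (is "?l = ?r")
proof
  fix k
  show "?l k = ?r k"
  proof (cases "k \<in> Mor G")
    case True
    interpret K: unital_nonassoc_ring "B (Cod G k)" using True BC_ring by blast
    let ?x = "homogeneous G B g a" and ?y = "homogeneous G B h b"
    have c: "?x \<in> carrier A" "?y \<in> carrier A" using assms homogeneous_closed by auto
    have l: "?l k = finsum (B (Cod G k)) (prod_term ?x ?y) (factors {g} {h} k)"
      by (rule mult_eq) (use c True in \<open>auto simp: supp_def homogeneous_def\<close>)
    show ?thesis
    proof (cases "Dom G g = Cod G h \<and> Comp G g h = k")
      case gh: True
      have f: "factors {g} {h} k = {(g, h)}" using gh assms by (auto simp: factors_def)
      have "prod_term ?x ?y (g, h) \<in> carrier (B (Cod G k))"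
        by (rule prod_term_closed[OF c, of _ "{g}" "{h}"]) (simp add: f)
      then have "?l k = prod_term ?x ?y (g, h)"
        unfolding l f using K.finsum_insert[of "{}" "(g, h)" "prod_term ?x ?y"] by simp
      then show ?thesis
        using gh assms True by (auto simp: prod_term_def homogeneous_def)
    next
      case False
      then have f: "factors {g} {h} k = {}" by (auto simp: factors_def)
      show ?thesis unfolding l f using False True
        by (auto simp: homogeneous_def crossed_product_def)
    qed
  qed (simp add: crossed_product_def homogeneous_def)
qed

lemma base_embed_summand:
  "e \<in> Ob G \<Longrightarrow> base_embed G B (summand_incl (Ob G) B e b) = homogeneous G B e b"
  using Ob_subset Cod_Ob
  by (auto simp: base_embed_def summand_incl_def homogeneous_def fun_eq_iff)

lemma inj_base_embed: "inj_on (base_embed G B) (carrier (direct_sum (Ob G) B))"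
proof (rule inj_onI)
  fix x y assume "x \<in> carrier (direct_sum (Ob G) B)" "y \<in> carrier (direct_sum (Ob G) B)"
    and eq: "base_embed G B x = base_embed G B y"
  then have xy: "x \<in> extensional (Ob G)" "y \<in> extensional (Ob G)"
    by (auto simp: direct_sum_def PiE_def)
  show "x = y"
  proof (rule extensionalityI[OF xy])
    show "x e = y e" if "e \<in> Ob G" for e
      using fun_cong[OF eq, of e] that Ob_subset by (auto simp: base_embed_def)
  qed
qed

end

end

theory Submission
  imports Defs
begin

text \<open>
  The ideal \<open>I\<close> is determined by its components, and \<open>JA\<close> (with \<open>J\<close> the copy of \<open>I\<close> in the crossed
  product \<open>A\<close>) consists exactly of the formal sums whose coefficient at \<open>u\<^sub>k\<close> lies in the component of
  \<open>I\<close> at the codomain of \<open>k\<close>, because \<open>b u\<^sub>k\<close> is the product of \<open>b u\<^bsub>c(k)\<^esub>\<close> and \<open>1 u\<^sub>k\<close>.  Since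
  the coefficient of \<open>a j\<close> at \<open>u\<^sub>k\<close> is \<open>a\<^sub>k\<close> times the image of \<open>j\<^bsub>d(k)\<^esub>\<close> under \<open>\<sigma>\<^sub>k\<close>, the
  inclusion of \<open>AJ\<close> in \<open>JA\<close> says that \<open>\<sigma>\<^sub>k\<close> maps components of \<open>I\<close> into components of \<open>I\<close>.
\<close>

section \<open>Finite sums of products\<close>

text \<open>Induction on the number of summands. The locale gives no law for
  \<open>\<otimes>\<close>, so the products are known to lie in the carrier only because they lie in
  \<open>K\<close>.\<close>

lemma (in abelian_monoid) set_prod_subsetI:
  assumes K: "K \<subseteq> carrier G" "\<zero> \<in> K" "\<And>u v. \<lbrakk>u \<in> K; v \<in> K\<rbrakk> \<Longrightarrow> u \<oplus> v \<in> K"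
    and prod: "\<And>x y. \<lbrakk>x \<in> X; y \<in> Y\<rbrakk> \<Longrightarrow> x \<otimes> y \<in> K"
  shows "set_prod G X Y \<subseteq> K"
proof -
  have "(\<Oplus>i\<in>{..<n}. x i \<otimes> y i) \<in> K" if "\<forall>i<n. x i \<in> X \<and> y i \<in> Y" for n :: nat and x y
    using that
  proof (induction n)
    case 0
    then show ?case using K by simp
  next
    case (Suc n)
    then have "x i \<otimes> y i \<in> K" if "i \<le> n" for i using that prod by auto
    then have "(\<Oplus>i\<in>insert n {..<n}. x i \<otimes> y i) = x n \<otimes> y n \<oplus> (\<Oplus>i\<in>{..<n}. x i \<otimes> y i)"
      using K(1) by (intro finsum_insert) auto
    then show ?case using Suc prod K(3) by (auto simp: lessThan_Suc)
  qed
  then show ?thesis by (auto simp: set_prod_def)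
qed

text \<open>\<open>set_prod\<close> indexes its sums by initial segments of the naturals; a
  bijection from such a segment onto \<open>S\<close> frees the choice of index set.\<close>

lemma (in abelian_monoid) finsum_in_set_prod:
  assumes "finite S" "\<And>s. s \<in> S \<Longrightarrow> x s \<in> X \<and> y s \<in> Y \<and> x s \<otimes> y s \<in> carrier G"
  shows "(\<Oplus>s\<in>S. x s \<otimes> y s) \<in> set_prod G X Y"
proof -
  obtain h :: "nat \<Rightarrow> _" where h: "bij_betw h {..<card S} S"
    using ex_bij_betw_nat_finite[OF assms(1)] by (auto simp: atLeast0LessThan)
  then have hS: "h ` {..<card S} = S" and inj: "inj_on h {..<card S}"
    by (auto simp: bij_betw_def)
  have "(\<Oplus>s\<in>S. x s \<otimes> y s) = (\<Oplus>i\<in>{..<card S}. x (h i) \<otimes> y (h i))"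
    using finsum_reindex[OF _ inj, of "\<lambda>s. x s \<otimes> y s"] assms(2) by (auto simp: hS)
  moreover have "\<forall>i<card S. x (h i) \<in> X \<and> y (h i) \<in> Y"
    using assms(2) hS by blast
  ultimately show ?thesis
    unfolding set_prod_def by (intro CollectI exI[of _ "card S"] exI[of _ "x \<circ> h"] exI[of _ "y \<circ> h"]) simp
qed

lemma (in abelian_monoid) mult_in_set_prod:
  assumes "x \<in> X" "y \<in> Y" "x \<otimes> y \<in> carrier G"
  shows "x \<otimes> y \<in> set_prod G X Y"
  using finsum_in_set_prod[of "{()}" "\<lambda>_. x" X "\<lambda>_. y" Y] finsum_insert[of "{}" "()" "\<lambda>_. x \<otimes> y"] assms
  by simp

section \<open>Products with elements of the base ring\<close>

context crossed_system
begin

abbreviation DS where "DS \<equiv> direct_sum (Ob G) B"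

lemma DS_mem: "\<lbrakk>b \<in> carrier DS; e \<in> Ob G\<rbrakk> \<Longrightarrow> b e \<in> carrier (B e)"
  by (auto simp: direct_sum_def dest: PiE_mem)

lemma B_zero_closed: "e \<in> Ob G \<Longrightarrow> \<zero>\<^bsub>B e\<^esub> \<in> carrier (B e)"
  using B_ring
  by (simp add: unital_nonassoc_ring_def nonassoc_ring_def abelian_group_def abelian_monoid.zero_closed)

lemma summand_incl_closed:
  assumes "e \<in> Ob G" "b \<in> carrier (B e)"
  shows "summand_incl (Ob G) B e b \<in> carrier DS"
proof -
  have "{e' \<in> Ob G. summand_incl (Ob G) B e b e' \<noteq> \<zero>\<^bsub>B e'\<^esub>} \<subseteq> {e}"
    by (auto simp: summand_incl_def)
  then have "finite {e' \<in> Ob G. summand_incl (Ob G) B e b e' \<noteq> \<zero>\<^bsub>B e'\<^esub>}"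
    by (rule finite_subset) simp
  then show ?thesis
    using assms B_zero_closed by (auto simp: direct_sum_def summand_incl_def)
qed

lemma base_embed_closed:
  assumes "b \<in> carrier DS"
  shows "base_embed G B b \<in> carrier A"
proof -
  have "supp (base_embed G B b) \<subseteq> {e \<in> Ob G. b e \<noteq> \<zero>\<^bsub>B e\<^esub>}"
    by (auto simp: supp_def base_embed_def Cod_Ob split: if_splits)
  then have "finite (supp (base_embed G B b))"
    by (rule finite_subset) (use assms in \<open>auto simp: direct_sum_def\<close>)
  then show ?thesis
    using DS_mem[OF assms] B_zero_closed Cod_in
    by (auto simp: A_carrier base_embed_def Cod_Ob)
qed

text \<open>The only factorisation of \<open>k\<close> with an identity as second factor is \<open>k d(k)\<close>.\<close>

lemma mult_base_embed:
  assumes a: "a \<in> carrier A" and b: "b \<in> carrier DS" and k: "k \<in> Mor G"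
  shows "(a \<otimes>\<^bsub>A\<^esub> base_embed G B b) k = a k \<otimes>\<^bsub>B (Cod G k)\<^esub> \<sigma> k (b (Dom G k))"
proof -
  interpret K: unital_nonassoc_ring "B (Cod G k)" using k BC_ring by blast
  let ?b = "base_embed G B b"
  have b': "?b \<in> carrier A" using b by (rule base_embed_closed)
  \<comment> \<open>\<open>mult_eq\<close> allows any finite supersets of the supports. With
    \<open>k\<close> and \<open>Dom G k\<close> inserted, the set of factorisations is a singleton
    even where a coefficient vanishes, which saves a case distinction.\<close>
  let ?S = "insert k (supp a)" and ?T = "insert (Dom G k) (supp ?b)"
  have T: "?T \<subseteq> Ob G"
    using Dom_in[OF k] by (auto simp: supp_def base_embed_def split: if_splits)
  have f: "factors ?S ?T k = {(k, Dom G k)}"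
  proof
    show "factors ?S ?T k \<subseteq> {(k, Dom G k)}"
    proof
      fix p assume p: "p \<in> factors ?S ?T k"
      obtain g h where gh: "p = (g, h)" "g \<in> Mor G" "h \<in> ?T" "Dom G g = Cod G h" "Comp G g h = k"
        using p by (auto simp: factors_def)
      have "Cod G h = h" using gh(3) T Cod_Ob by blast
      then have "h = Dom G g" using gh(4) by simp
      then show "p \<in> {(k, Dom G k)}" using gh(1,5) Comp_Dom[OF gh(2)] by simp
    qed
    show "{(k, Dom G k)} \<subseteq> factors ?S ?T k"
      using k Dom_in[OF k] Ob_subset by (auto simp: factors_def Comp_Dom Cod_Ob)
  qed
  have c: "a k \<otimes>\<^bsub>B (Cod G k)\<^esub> \<sigma> k (b (Dom G k)) \<in> carrier (B (Cod G k))"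
    using A_mem[OF a k] DS_mem[OF b Dom_in[OF k]] \<sigma>_closed[OF k] K.mult_closed by blast
  have t: "prod_term a ?b (k, Dom G k) = a k \<otimes>\<^bsub>B (Cod G k)\<^esub> \<sigma> k (b (Dom G k))"
    using Dom_in[OF k] Ob_subset K.unit_right[OF c] \<alpha>_Dom[OF k]
    by (auto simp: prod_term_def base_embed_def)
  have "(a \<otimes>\<^bsub>A\<^esub> ?b) k = finsum (B (Cod G k)) (prod_term a ?b) (factors ?S ?T k)"
    by (rule mult_eq[OF a b' k]) (use a b' in \<open>auto simp: A_carrier\<close>)
  then show ?thesis
    unfolding f using K.finsum_insert[of "{}" "(k, Dom G k)" "prod_term a ?b"] c t by simp
qed

text \<open>Mirror image of \<open>mult_base_embed\<close>: with an identity as first factor, only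
  c(k) k remains. No twist appears, since \<sigma> is the identity at objects and
  \<open>\<alpha> (Cod G k) k\<close> is 1.\<close>

lemma base_embed_mult:
  assumes a: "a \<in> carrier A" and b: "b \<in> carrier DS" and k: "k \<in> Mor G"
  shows "(base_embed G B b \<otimes>\<^bsub>A\<^esub> a) k = b (Cod G k) \<otimes>\<^bsub>B (Cod G k)\<^esub> a k"
proof -
  interpret K: unital_nonassoc_ring "B (Cod G k)" using k BC_ring by blast
  let ?b = "base_embed G B b"
  have b': "?b \<in> carrier A" using b by (rule base_embed_closed)
  let ?S = "insert (Cod G k) (supp ?b)" and ?T = "insert k (supp a)"
  have S: "?S \<subseteq> Ob G"
    using Cod_in[OF k] by (auto simp: supp_def base_embed_def split: if_splits)
  have f: "factors ?S ?T k = {(Cod G k, k)}"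
  proof
    show "factors ?S ?T k \<subseteq> {(Cod G k, k)}"
    proof
      fix p assume p: "p \<in> factors ?S ?T k"
      obtain g h where gh: "p = (g, h)" "g \<in> ?S" "h \<in> Mor G" "Dom G g = Cod G h" "Comp G g h = k"
        using p by (auto simp: factors_def)
      have "Dom G g = g" using gh(2) S Dom_Ob by blast
      then have "g = Cod G h" using gh(4) by simp
      then show "p \<in> {(Cod G k, k)}" using gh(1,5) Comp_Cod[OF gh(3)] by simp
    qed
    show "{(Cod G k, k)} \<subseteq> factors ?S ?T k"
      using k Cod_in[OF k] Ob_subset by (auto simp: factors_def Comp_Cod Dom_Ob)
  qed
  have c: "b (Cod G k) \<otimes>\<^bsub>B (Cod G k)\<^esub> a k \<in> carrier (B (Cod G k))"
    using A_mem[OF a k] DS_mem[OF b Cod_in[OF k]] K.mult_closed by blast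
  have t: "prod_term ?b a (Cod G k, k) = b (Cod G k) \<otimes>\<^bsub>B (Cod G k)\<^esub> a k"
    using Cod_in[OF k] Ob_subset K.unit_right[OF c] \<alpha>_Cod[OF k] \<sigma>_Ob[OF Cod_in[OF k] A_mem[OF a k]]
    by (auto simp: prod_term_def base_embed_def Cod_Ob)
  have "(?b \<otimes>\<^bsub>A\<^esub> a) k = finsum (B (Cod G k)) (prod_term ?b a) (factors ?S ?T k)"
    by (rule mult_eq[OF b' a k]) (use a b' in \<open>auto simp: A_carrier\<close>)
  then show ?thesis
    unfolding f using K.finsum_insert[of "{}" "(Cod G k, k)" "prod_term ?b a"] c t by simp
qed

section \<open>Sums in the crossed product, coefficient by coefficient\<close>

lemma A_zero_apply: "k \<in> Mor G \<Longrightarrow> \<zero>\<^bsub>A\<^esub> k = \<zero>\<^bsub>B (Cod G k)\<^esub>"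
  by (simp add: crossed_product_def)

lemma A_add_apply: "k \<in> Mor G \<Longrightarrow> (x \<oplus>\<^bsub>A\<^esub> y) k = x k \<oplus>\<^bsub>B (Cod G k)\<^esub> y k"
  by (simp add: crossed_product_def)

text \<open>Taking the coefficient at \<open>k\<close> is an additive map into
  \<open>B (Cod G k)\<close>, hence commutes with finite sums.\<close>

lemma finsum_apply:
  assumes "finite S" "\<And>s. s \<in> S \<Longrightarrow> f s \<in> carrier A" "k \<in> Mor G"
  shows "finsum A f S k = finsum (B (Cod G k)) (\<lambda>s. f s k) S"
proof -
  interpret A: abelian_group A by (rule A_abelian_group)
  interpret K: unital_nonassoc_ring "B (Cod G k)" using assms(3) BC_ring by blast
  show ?thesis
    using assms(1,2)
  proof (induction S)
    case empty
    then show ?case using assms(3) by (simp add: A_zero_apply)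
  next
    case (insert s S)
    have "finsum A f (insert s S) k = (f s \<oplus>\<^bsub>A\<^esub> finsum A f S) k"
      using insert by (subst A.finsum_insert) auto
    also have "\<dots> = f s k \<oplus>\<^bsub>B (Cod G k)\<^esub> finsum (B (Cod G k)) (\<lambda>s. f s k) S"
      using insert assms(3) by (simp add: A_add_apply)
    also have "\<dots> = finsum (B (Cod G k)) (\<lambda>s. f s k) (insert s S)"
      using insert A_mem[OF _ assms(3)] by (subst K.finsum_insert) auto
    finally show ?case .
  qed
qed

lemma finsum_homogeneous:
  assumes a: "a \<in> carrier A"
  shows "finsum A (\<lambda>g. homogeneous G B g (a g)) (supp a) = a" (is "?s = a")
proof -
  interpret A: abelian_group A by (rule A_abelian_group)
  have fin: "finite (supp a)" using a by (simp add: A_carrier)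
  have sM: "g \<in> Mor G" if "g \<in> supp a" for g using that by (simp add: supp_def)
  have c: "homogeneous G B g (a g) \<in> carrier A" if "g \<in> supp a" for g
    using homogeneous_closed A_mem[OF a] sM[OF that] by blast
  \<comment> \<open>Both sides are \<open>undefined\<close> off \<open>Mor G\<close>, so comparing
    coefficients at morphisms suffices.\<close>
  have ext: "?s \<in> extensional (Mor G)" "a \<in> extensional (Mor G)"
    using A.finsum_closed[of "\<lambda>g. homogeneous G B g (a g)" "supp a"] c a
    by (auto simp: A_carrier PiE_def)
  show ?thesis
  proof (rule extensionalityI[OF ext])
    fix k assume k: "k \<in> Mor G"
    interpret K: unital_nonassoc_ring "B (Cod G k)" using k BC_ring by blast
    have ak: "a k \<in> carrier (B (Cod G k))" using A_mem[OF a k] .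
    have "?s k = finsum (B (Cod G k)) (\<lambda>g. homogeneous G B g (a g) k) (supp a)"
      by (rule finsum_apply[OF fin c k])
    also have "\<dots> = finsum (B (Cod G k)) (\<lambda>g. if k = g then a k else \<zero>\<^bsub>B (Cod G k)\<^esub>) (supp a)"
      by (rule K.finsum_cong') (use k ak in \<open>auto simp: homogeneous_def\<close>)
    also have "\<dots> = a k"
    proof (cases "k \<in> supp a")
      case True
      then show ?thesis
        using K.add.finprod_singleton[OF True fin, of "\<lambda>_. a k"] ak by (simp add: finsum_def)
    next
      case False
      then have "finsum (B (Cod G k)) (\<lambda>g. if k = g then a k else \<zero>\<^bsub>B (Cod G k)\<^esub>) (supp a)
          = finsum (B (Cod G k)) (\<lambda>g. \<zero>\<^bsub>B (Cod G k)\<^esub>) (supp a)"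
        by (intro K.finsum_cong') auto
      with False k show ?thesis by (auto simp: supp_def)
    qed
    finally show "?s k = a k" .
  qed
qed

end

section \<open>Components of an ideal of the base ring\<close>

locale crossed_system_ideal = crossed_system G B \<sigma> \<alpha> + nonassoc_ideal I "direct_sum (Ob G) B"
  for G :: "'g category" and B :: "'g \<Rightarrow> 'b ring" and \<sigma> \<alpha> and I :: "('g \<Rightarrow> 'b) set"
begin

abbreviation component where "component \<equiv> ideal_component G B I"

lemma comp_iff:
  "e \<in> Ob G \<Longrightarrow> b \<in> component e \<longleftrightarrow> b \<in> carrier (B e) \<and> summand_incl (Ob G) B e b \<in> I"
  by (simp add: ideal_component_def)

text \<open>Multiplication by the identity of \<open>B e\<close> projects onto the summand \<open>B e\<close>.\<close>

lemma ideal_apply_in_comp: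
  assumes i: "i \<in> I" and e: "e \<in> Ob G"
  shows "i e \<in> component e"
proof -
  have iD: "i \<in> carrier DS" using i a_subset by blast
  have one: "\<one>\<^bsub>B e\<^esub> \<in> carrier (B e)"
    using B_ring[OF e] by (rule unital_nonassoc_ring.unit_closed)
  have "i \<otimes>\<^bsub>DS\<^esub> summand_incl (Ob G) B e \<one>\<^bsub>B e\<^esub> = summand_incl (Ob G) B e (i e)"
    using DS_mem[OF iD] unital_nonassoc_ring.unit_right[OF B_ring]
      nonassoc_ring.mult_zero[OF unital_nonassoc_ring.axioms(1)[OF B_ring]]
    by (auto simp: direct_sum_def summand_incl_def fun_eq_iff)
  then show ?thesis
    using mult_in_right[OF i summand_incl_closed[OF e one]] DS_mem[OF iD e]
    by (simp add: comp_iff[OF e])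
qed

lemma comp_zero: "e \<in> Ob G \<Longrightarrow> \<zero>\<^bsub>B e\<^esub> \<in> component e"
  using ideal_apply_in_comp[OF zero_closed] by (simp add: direct_sum_def)

text \<open>Include both elements into the direct sum, add there inside \<open>I\<close>, and
  project back with \<open>ideal_apply_in_comp\<close>. The same detour gives
  \<open>comp_mult\<close>.\<close>

lemma comp_add:
  assumes e: "e \<in> Ob G" and "b \<in> component e" "c \<in> component e"
  shows "b \<oplus>\<^bsub>B e\<^esub> c \<in> component e"
proof -
  have "summand_incl (Ob G) B e b \<oplus>\<^bsub>DS\<^esub> summand_incl (Ob G) B e c \<in> I"
    using assms by (simp add: comp_iff[OF e] a_closed)
  from ideal_apply_in_comp[OF this e] show ?thesis
    using e by (simp add: direct_sum_def summand_incl_def)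
qed

lemma comp_mult:
  assumes e: "e \<in> Ob G" and "b \<in> component e" "x \<in> carrier (B e)"
  shows "x \<otimes>\<^bsub>B e\<^esub> b \<in> component e" "b \<otimes>\<^bsub>B e\<^esub> x \<in> component e"
proof -
  have b: "summand_incl (Ob G) B e b \<in> I" using assms by (simp add: comp_iff[OF e])
  have x: "summand_incl (Ob G) B e x \<in> carrier DS" using e assms(3) by (rule summand_incl_closed)
  show "x \<otimes>\<^bsub>B e\<^esub> b \<in> component e" "b \<otimes>\<^bsub>B e\<^esub> x \<in> component e"
    using ideal_apply_in_comp[OF mult_in_left[OF b x] e]
      ideal_apply_in_comp[OF mult_in_right[OF b x] e] e
    by (simp_all add: direct_sum_def summand_incl_def)
qed

section \<open>Description of JA by coefficients\<close>

text \<open>This is JA by \<open>set_prod_base_embed\<close>; in this form membership can be tested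
  without exhibiting a sum of products.\<close>

definition coeff_ideal :: "('g \<Rightarrow> 'b) set" where
  "coeff_ideal = {a \<in> carrier A. \<forall>k\<in>Mor G. a k \<in> component (Cod G k)}"

text \<open>Components contain zero and are closed under addition, so both inclusions into
  \<open>coeff_ideal\<close> need checking on single products only.\<close>

lemma set_prod_subset_coeff_ideal:
  assumes "\<And>x y. \<lbrakk>x \<in> X; y \<in> Y\<rbrakk> \<Longrightarrow> x \<otimes>\<^bsub>A\<^esub> y \<in> coeff_ideal"
  shows "set_prod A X Y \<subseteq> coeff_ideal"
proof -
  interpret A: abelian_group A by (rule A_abelian_group)
  show ?thesis
  proof (rule A.set_prod_subsetI[OF _ _ _ assms])
    show "\<zero>\<^bsub>A\<^esub> \<in> coeff_ideal"
      using A.zero_closed comp_zero Cod_in by (simp add: coeff_ideal_def A_zero_apply)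
    show "u \<oplus>\<^bsub>A\<^esub> v \<in> coeff_ideal" if "u \<in> coeff_ideal" "v \<in> coeff_ideal" for u v
      using that A.a_closed[of u v] comp_add Cod_in by (simp add: coeff_ideal_def A_add_apply)
  qed (auto simp: coeff_ideal_def)
qed

lemma set_prod_base_embed: "set_prod A (base_embed G B ` I) (carrier A) = coeff_ideal"
proof
  interpret A: nonassoc_ring A by (rule crossed_product_nonassoc_ring)
  show "set_prod A (base_embed G B ` I) (carrier A) \<subseteq> coeff_ideal"
  proof (rule set_prod_subset_coeff_ideal)
    fix x a assume "x \<in> base_embed G B ` I" and a: "a \<in> carrier A"
    then obtain i where x: "x = base_embed G B i" and i: "i \<in> I" by blast
    have iD: "i \<in> carrier DS" using i a_subset by blast
    show "x \<otimes>\<^bsub>A\<^esub> a \<in> coeff_ideal"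
      unfolding x coeff_ideal_def
      using A.mult_closed[OF base_embed_closed[OF iD] a] base_embed_mult[OF a iD]
        comp_mult(2)[OF Cod_in ideal_apply_in_comp[OF i Cod_in] A_mem[OF a]] by simp
  qed
  show "coeff_ideal \<subseteq> set_prod A (base_embed G B ` I) (carrier A)"
  proof
    fix a assume "a \<in> coeff_ideal"
    then have a: "a \<in> carrier A" and ac: "\<And>k. k \<in> Mor G \<Longrightarrow> a k \<in> component (Cod G k)"
      by (auto simp: coeff_ideal_def)
    \<comment> \<open>Each homogeneous part of \<open>a\<close> is split into a factor in J,
      available because \<open>a g\<close> lies in the component at c(g), and a factor with
      coefficient 1.\<close>
    let ?x = "\<lambda>g. homogeneous G B (Cod G g) (a g)" and ?y = "\<lambda>g. homogeneous G B g \<one>\<^bsub>B (Cod G g)\<^esub>"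
    have xy: "?x g \<in> base_embed G B ` I \<and> ?y g \<in> carrier A \<and> ?x g \<otimes>\<^bsub>A\<^esub> ?y g = homogeneous G B g (a g)"
      if "g \<in> supp a" for g
    proof -
      have g: "g \<in> Mor G" using that by (simp add: supp_def)
      interpret K: unital_nonassoc_ring "B (Cod G g)" using g BC_ring by blast
      have "?x g \<in> base_embed G B ` I"
        using base_embed_summand[OF Cod_in[OF g], of "a g", symmetric] ac[OF g]
        by (simp add: comp_iff[OF Cod_in[OF g]])
      moreover have "?x g \<otimes>\<^bsub>A\<^esub> ?y g = homogeneous G B g (a g)"
        using homogeneous_mult[of "Cod G g" g "a g" "\<one>\<^bsub>B (Cod G g)\<^esub>"] g Cod_in[OF g] Ob_subset
          A_mem[OF a g] K.unit_closed K.unit_right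
        by (auto simp: Cod_Ob Dom_Ob \<sigma>_Ob \<alpha>_Cod Comp_Cod)
      ultimately show ?thesis using homogeneous_closed[OF g K.unit_closed] by blast
    qed
    have h: "homogeneous G B g (a g) \<in> carrier A" if "g \<in> supp a" for g
      using that homogeneous_closed A_mem[OF a] by (auto simp: supp_def)
    have "(\<Oplus>\<^bsub>A\<^esub>g\<in>supp a. ?x g \<otimes>\<^bsub>A\<^esub> ?y g) = (\<Oplus>\<^bsub>A\<^esub>g\<in>supp a. homogeneous G B g (a g))"
      by (rule A.finsum_cong') (use xy h in auto)
    also have "\<dots> = a" by (rule finsum_homogeneous[OF a])
    finally show "a \<in> set_prod A (base_embed G B ` I) (carrier A)"
      using A.finsum_in_set_prod[of "supp a" ?x "base_embed G B ` I" ?y "carrier A"] xy h a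
      by (simp add: A_carrier)
  qed
qed

section \<open>The two notions of invariance\<close>

theorem G_invariant_iff_A_invariant: "G_invariant G B \<sigma> I \<longleftrightarrow> A_invariant G B \<sigma> \<alpha> I"
proof -
  interpret A: nonassoc_ring A by (rule crossed_product_nonassoc_ring)
  have A_inv: "A_invariant G B \<sigma> \<alpha> I \<longleftrightarrow> set_prod A (carrier A) (base_embed G B ` I) \<subseteq> coeff_ideal"
    by (simp add: A_invariant_def Let_def set_prod_base_embed)
  show ?thesis
    unfolding A_inv
  proof
    assume inv: "G_invariant G B \<sigma> I"
    show "set_prod A (carrier A) (base_embed G B ` I) \<subseteq> coeff_ideal"
    proof (rule set_prod_subset_coeff_ideal)
      fix a x assume a: "a \<in> carrier A" and "x \<in> base_embed G B ` I"
      then obtain i where x: "x = base_embed G B i" and i: "i \<in> I" by blast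
      have iD: "i \<in> carrier DS" using i a_subset by blast
      \<comment> \<open>By \<open>mult_base_embed\<close> the coefficient of the product at
        \<open>k\<close> is \<open>a k\<close> times this element, and components absorb left
        factors.\<close>
      have "\<sigma> k (i (Dom G k)) \<in> component (Cod G k)" if "k \<in> Mor G" for k
        using inv ideal_apply_in_comp[OF i Dom_in[OF that]] that by (auto simp: G_invariant_def)
      then show "a \<otimes>\<^bsub>A\<^esub> x \<in> coeff_ideal"
        unfolding x coeff_ideal_def
        using A.mult_closed[OF a base_embed_closed[OF iD]] mult_base_embed[OF a iD]
          comp_mult(1)[OF Cod_in _ A_mem[OF a]] by simp
    qed
  next
    assume sub: "set_prod A (carrier A) (base_embed G B ` I) \<subseteq> coeff_ideal"
    have "\<sigma> g b \<in> component (Cod G g)" if g: "g \<in> Mor G" and b: "b \<in> component (Dom G g)" for g b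
    proof -
      interpret K: unital_nonassoc_ring "B (Cod G g)" using g BC_ring by blast
      \<comment> \<open>These witnesses isolate \<open>\<sigma> g b\<close>: the coefficient of
        their product at \<open>g\<close> is 1 times \<open>\<sigma> g b\<close>.\<close>
      let ?a = "homogeneous G B g \<one>\<^bsub>B (Cod G g)\<^esub>" and ?i = "summand_incl (Ob G) B (Dom G g) b"
      have bB: "b \<in> carrier (B (Dom G g))" and i: "?i \<in> I"
        using b comp_iff[OF Dom_in[OF g]] by auto
      have iD: "?i \<in> carrier DS" using i a_subset by blast
      have a: "?a \<in> carrier A" using homogeneous_closed[OF g K.unit_closed] .
      have "?a \<otimes>\<^bsub>A\<^esub> base_embed G B ?i \<in> coeff_ideal"
        using A.mult_in_set_prod[OF a imageI[where f = "base_embed G B", OF i]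
            A.mult_closed[OF a base_embed_closed[OF iD]]] sub
        by (rule set_mp[rotated])
      then have "(?a \<otimes>\<^bsub>A\<^esub> base_embed G B ?i) g \<in> component (Cod G g)"
        using g by (simp add: coeff_ideal_def)
      then show ?thesis
        using mult_base_embed[OF a iD g] g Dom_in[OF g] K.unit_left[OF \<sigma>_closed[OF g bB]]
        by (simp add: homogeneous_def summand_incl_def)
    qed
    then show "G_invariant G B \<sigma> I" by (auto simp: G_invariant_def)
  qed
qed

end

theorem proposition3p12:
  fixes G :: "'g category"
    and B :: "'g \<Rightarrow> 'b ring"
    and \<sigma> :: "'g \<Rightarrow> 'b \<Rightarrow> 'b"
    and \<alpha> :: "'g \<Rightarrow> 'g \<Rightarrow> 'b"
    and I :: "('g \<Rightarrow> 'b) set"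
  assumes "crossed_system G B \<sigma> \<alpha>"
    and "nonassoc_ideal I (direct_sum (Ob G) B)"
  shows "G_invariant G B \<sigma> I \<longleftrightarrow> A_invariant G B \<sigma> \<alpha> I"
proof -
  interpret crossed_system_ideal G B \<sigma> \<alpha> I
    using assms by (rule crossed_system_ideal.intro)
  show ?thesis by (rule G_invariant_iff_A_invariant)
qed

end
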